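(* Let $\mathcal G$ be a strongly connected digraph on $N$ nodes and let $\{\mathbf A(k)\}_{k\in\mathbb Z_+}$ be the sequence of weight matrices, with associated balance vectors $\mathbf b(k)=(b_i(k))_{i\in\mathcal V}=(\mathbf A(k)-\mathbf A(k)^\top)\mathbf 1$, generated by the quantized weight-balancing recursion described in the context, where the numbers of bits, the step-size and the initial weight matrix satisfy the bit assumption and the step-size/initialization assumption stated there. Then: (a) $\|\mathbf b(k)\|_1=\mathcal O(1/k)$ as $k\to\infty$; (b) the limit $\lim_{k\to\infty}\mathbf A(k)=\mathbf A^*$ exists and $\mathbf A^*$ is weight-balanced, i.e. $\mathbf A^*\ge \mathbf 0$, $\mathbf A^*\neq\mathbf 0$ and $(\mathbf A^*-(\mathbf A^* )^\top)\mathbf 1=\mathbf 0$; (c) $0<a_{\min}\le a_{ij}(k)\le a_{\max}$ for all $(j,i)\in\mathcal E$ and all $k\in\mathbb Z_+$, where $a_{\min},a_{\max}$ are the constants defined in the context.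
   Context: $\mathbb Z_+=\{0,1,2,\dots\}$, $\mathbb Z_{++}=\{1,2,\dots\}$, $\mathrm{sgn}(0)=0$. Graph: $\mathcal G=(\mathcal V,\mathcal E)$ is a strongly connected digraph, $\mathcal V=\{1,\dots,N\}$, $N\ge 2$, without self-loops; $(i,j)\in\mathcal E$ is an edge from $i$ to $j$. $\mathcal N_i^-=\{j:(j,i)\in\mathcal E\}$, $\mathcal N_i^+=\{j:(i,j)\in\mathcal E\}$, $d_i^\pm=|\mathcal N_i^\pm|$. Bit assumption: there are a sequence $B^{(w)}(k)\in\{0,1\}$, $k\in\mathbb Z_+$, and $W\in\mathbb Z_{++}$ with $\sum_{t=nW}^{(n+1)W-1}B^{(w)}(t)\ge 1$ for all $n\in\mathbb Z_+$, and there is $B_{\max}\in\mathbb Z_+$ such that the integers $B_i^{(w)}(k)$ ($i\in\mathcal V$, $k\in\mathbb Z_+$) satisfy, for all $i$: $1\le B_i^{(w)}(k)\le B_{\max}$ if $B^{(w)}(k)=1$, and $B_i^{(w)}(k)=0$ if $B^{(w)}(k)=0$. Step-size/initialization assumption: for some integer $c_1\ge 2$ and real $c_2>0$, for every $k\in\mathbb Z_+$ there is $n\in\mathbb Z_+$ with $(c_1^n-1)c_2\le k\le (c_1^{n+1}-1)c_2-1$ and $\gamma(k)=c_1^{-n}$; and $a_{ij}(0)=1$ if $(j,i)\in\mathcal E$, $a_{ij}(0)=0$ otherwise. Weight-balancing recursion: $\mathbf A(k)=(a_{ij}(k))$, $b_i(0)=\sum_{j\in\mathcal N_i^-}a_{ij}(0)-\sum_{j\in\mathcal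 N_i^+}a_{ji}(0)$, and for each $k\in\mathbb Z_+$ $$n_i(k)=\mathrm{sgn}(b_i(k))\min\Big\{\tfrac{2}{2^{B_i^{(w)}(k)}}\Big[\Big\lceil \tfrac{2^{B_i^{(w)}(k)}|b_i(k)|}{2d_i^+\gamma(k)}\Big\rceil-1\Big],\,1\Big\}\ \text{ if } B_i^{(w)}(k)\ge 1,\qquad n_i(k)=0\ \text{ if }B_i^{(w)}(k)=0,$$ $$a_{ij}(k+1)=a_{ij}(k)+\gamma(k)n_j(k)\quad (j\in\mathcal N_i^-),$$ $$b_i(k+1)=b_i(k)-\gamma(k)d_i^+n_i(k)+\gamma(k)\sum_{j\in\mathcal N_i^-}n_j(k),$$ with $a_{ij}(k)=0$ for all $k$ if $(j,i)\notin\mathcal E$. Constants: let $\mathbf L^+(0)=\mathrm{diag}(d_1^+,\dots,d_N^+)-\mathbf A(0)$. Its kernel is one-dimensional and spanned by a vector with strictly positive entries. Let $\mathbf a_{\rm m}=(a_{{\rm m},i})_i$ and $\mathbf a_{\rm M}=(a_{{\rm M},i})_i$ be the positive vectors in $\ker \mathbf L^+(0)$ normalized by $\max_i a_{{\rm m},i}=1$ and $\min_i a_{{\rm M},i}=1$. Then $a_{\min}=\min_i a_{{\rm m},i}$ and $a_{\max}=\max_i a_{{\rm M},i}$. *)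

theory Defs
  imports
    "HOL-Analysis.Analysis"
    "HOL-Library.Landau_Symbols"
    "Graph_Theory.Digraph_Component"
    "Graph_Theory.Pair_Digraph"
begin

text \<open>
  The nodes are the elements of a finite type; a digraph on all of them is a pair digraph with
  \<open>pverts G = UNIV\<close>.  An arc \<open>(i, j)\<close> goes from \<open>i\<close> to \<open>j\<close>, whereas the weight of the arc
  \<open>(j, i)\<close> is the matrix entry \<open>A $ i $ j\<close>.
\<close>

definition in_nbrs :: "'n pair_pre_digraph \<Rightarrow> 'n \<Rightarrow> 'n set" where
  "in_nbrs G i = {j. (j, i) \<in> parcs G}"

definition out_nbrs :: "'n pair_pre_digraph \<Rightarrow> 'n \<Rightarrow> 'n set" where
  "out_nbrs G i = {j. (i, j) \<in> parcs G}"

definition out_deg :: "'n pair_pre_digraph \<Rightarrow> 'n \<Rightarrow> nat" where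
  "out_deg G i = card (out_nbrs G i)"

text \<open>\<open>B i k\<close> is the number of bits that node \<open>i\<close> uses at time \<open>k\<close>.\<close>

definition bit_assumption :: "('n \<Rightarrow> nat \<Rightarrow> nat) \<Rightarrow> bool" where
  "bit_assumption B \<longleftrightarrow>
    (\<exists>(Bw :: nat \<Rightarrow> nat) (W :: nat) (Bmax :: nat).
       (\<forall>k. Bw k \<in> {0, 1}) \<and>
       1 \<le> W \<and>
       (\<forall>n. (\<Sum>t = n * W..(n + 1) * W - 1. Bw t) \<ge> 1) \<and>
       (\<forall>i k. (Bw k = 1 \<longrightarrow> 1 \<le> B i k \<and> B i k \<le> Bmax) \<and>
              (Bw k = 0 \<longrightarrow> B i k = 0)))"

definition step_size_assumption :: "(nat \<Rightarrow> real) \<Rightarrow> bool" where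
  "step_size_assumption \<gamma> \<longleftrightarrow>
    (\<exists>(c1 :: nat) (c2 :: real). 2 \<le> c1 \<and> 0 < c2 \<and>
       (\<forall>k. \<exists>n. (real c1 ^ n - 1) * c2 \<le> real k \<and>
                real k \<le> (real c1 ^ (n + 1) - 1) * c2 - 1 \<and>
                \<gamma> k = 1 / real c1 ^ n))"

definition init_assumption :: "'n::finite pair_pre_digraph \<Rightarrow> real^'n^'n \<Rightarrow> bool" where
  "init_assumption G A0 \<longleftrightarrow> (\<forall>i j. A0 $ i $ j = (if (j, i) \<in> parcs G then 1 else 0))"

text \<open>The transmitted value for \<open>m\<close> bits, out-degree \<open>d\<close>, step-size \<open>g\<close> and balance \<open>\<beta>\<close>.\<close>

definition quant :: "nat \<Rightarrow> nat \<Rightarrow> real \<Rightarrow> real \<Rightarrow> real" where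
  "quant m d g \<beta> =
    (if m \<ge> 1
     then sgn \<beta> * min (2 / 2 ^ m * (of_int \<lceil>2 ^ m * \<bar>\<beta>\<bar> / (2 * real d * g)\<rceil> - 1)) 1
     else 0)"

definition weight_balancing ::
    "'n::finite pair_pre_digraph \<Rightarrow> ('n \<Rightarrow> nat \<Rightarrow> nat) \<Rightarrow> (nat \<Rightarrow> real) \<Rightarrow>
     (nat \<Rightarrow> real^'n^'n) \<Rightarrow> (nat \<Rightarrow> real^'n) \<Rightarrow> bool" where
  "weight_balancing G B \<gamma> A b \<longleftrightarrow>
    (let n = (\<lambda>i k. quant (B i k) (out_deg G i) (\<gamma> k) (b k $ i)) in
      (\<forall>i. b 0 $ i = (\<Sum>j\<in>in_nbrs G i. A 0 $ i $ j) - (\<Sum>j\<in>out_nbrs G i. A 0 $ j $ i)) \<and>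
      (\<forall>k i j. j \<in> in_nbrs G i \<longrightarrow> A (k + 1) $ i $ j = A k $ i $ j + \<gamma> k * n j k) \<and>
      (\<forall>k i j. (j, i) \<notin> parcs G \<longrightarrow> A k $ i $ j = 0) \<and>
      (\<forall>k i. b (k + 1) $ i =
         b k $ i - \<gamma> k * real (out_deg G i) * n i k + \<gamma> k * (\<Sum>j\<in>in_nbrs G i. n j k)))"

definition weight_balanced :: "real^'n::finite^'n \<Rightarrow> bool" where
  "weight_balanced A \<longleftrightarrow>
    (\<forall>i j. 0 \<le> A $ i $ j) \<and> A \<noteq> 0 \<and> (A - transpose A) *v vec 1 = 0"

definition laplacian_out :: "'n::finite pair_pre_digraph \<Rightarrow> real^'n^'n \<Rightarrow> real^'n^'n" where
  "laplacian_out G A = (\<chi> i j. if i = j then real (out_deg G i) else 0) - A"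

text \<open>
  For a strongly connected \<open>G\<close> with 0-1 weights the kernel of \<open>laplacian_out G A0\<close> is a line
  spanned by a positive vector, so each of the two descriptions below determines a unique vector.
\<close>

definition a_m :: "'n::finite pair_pre_digraph \<Rightarrow> real^'n^'n \<Rightarrow> real^'n" where
  "a_m G A0 = (THE v. laplacian_out G A0 *v v = 0 \<and> (\<forall>i. 0 < v $ i) \<and> Max (range (($) v)) = 1)"

definition a_M :: "'n::finite pair_pre_digraph \<Rightarrow> real^'n^'n \<Rightarrow> real^'n" where
  "a_M G A0 = (THE v. laplacian_out G A0 *v v = 0 \<and> (\<forall>i. 0 < v $ i) \<and> Min (range (($) v)) = 1)"

definition a_min :: "'n::finite pair_pre_digraph \<Rightarrow> real^'n^'n \<Rightarrow> real" where
  "a_min G A0 = Min (range (($) (a_m G A0)))"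

definition a_max :: "'n::finite pair_pre_digraph \<Rightarrow> real^'n^'n \<Rightarrow> real" where
  "a_max G A0 = Max (range (($) (a_M G A0)))"

end

theory Submission
  imports Defs
begin

text \<open>
  All arcs leaving a node \<open>j\<close> start with weight 1 and receive the same increments, so the weights
  are given by one number \<open>h\<^sub>j(k)\<close> per node, and \<open>b(k) = -L h(k)\<close> for the Laplacian \<open>L = L\<^sup>+(0)\<close>.
  The entries of \<open>b(k)\<close> have sum 0.  In one step node \<open>i\<close> ships an amount \<open>\<gamma> n\<^sub>i\<close> of the sign of
  \<open>b\<^sub>i\<close> to each out-neighbour, in total never more than \<open>\<bar>b\<^sub>i\<bar>\<close>, and exactly \<open>\<gamma>\<close> to each as
  soon as bits are available and \<open>b\<^sub>i > d\<^sub>i\<^sup>+ \<gamma>\<close>.  These few facts (locale \<open>balancing\<close>) are all that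
  is used of the quantizer.

  \<^emph>\<open>Bounds.\<close>  A kernel vector of \<open>L\<close> is a stationary state.  Since a node never overshoots its
  balance, the recursion preserves \<open>h \<le> w\<close> and \<open>w \<le> h\<close> for every kernel vector \<open>w\<close> (lemmas
  \<open>upper_barrier\<close>, \<open>lower_barrier\<close>).  As \<open>h(0) = 1\<close> lies between \<open>a\<^sub>m\<close> and \<open>a\<^sub>M\<close>, so does every
  \<open>h(k)\<close>.  That \<open>L\<close> has a positive kernel vector, unique up to scaling, is a Perron-Frobenius
  argument on the strongly connected graph.

  \<^emph>\<open>Rate.\<close>  The norm \<open>\<parallel>b\<parallel>\<^sub>1\<close> never grows, and it drops by twice the amount of positive balance
  that is annihilated by negative balance (\<open>imbalance_drop\<close>).  If \<open>\<parallel>b\<parallel>\<^sub>1\<close> is large compared with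
  \<open>\<gamma>\<close>, then some node is so positive, and another so negative, that they keep their signs during
  a long window of fixed length.  The positive node emits at full rate.  Along a path to the
  negative node each intermediate node passes on at least the fraction \<open>1/N\<close> of what it receives
  from its predecessor, up to a bounded deposit and the amount annihilated on it
  (\<open>flow_arc\<close>).  The negative node emits nothing positive, so an amount of
  order \<open>\<gamma>\<close> must have been annihilated (\<open>window_decay\<close>).  As \<open>\<gamma>(k)\<close> is comparable to \<open>1/k\<close>, the norm sampled at multiples of the
  window length either is \<open>O(1/n)\<close> or drops by a fixed multiple of \<open>1/n\<close>; divergence of the
  harmonic series turns this into the bound \<open>O(1/k)\<close> (\<open>harmonic_decrease_bound\<close>).

  \<^emph>\<open>Limit.\<close>  The bound \<open>O(1/k)\<close> does not make the increments of \<open>h\<close> summable.  But \<open>h\<close> is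
  bounded, and every limit point lies in the kernel of \<open>L\<close> because \<open>b\<close> tends to 0.  Once \<open>h\<close> is
  squeezed between two close multiples of the positive kernel vector it stays there by the
  barriers, so \<open>h\<close> converges (\<open>h_converges\<close>).
\<close>


section \<open>Positive kernel vectors of the Laplacian\<close>

lemma det_zero_iff_kernel:
  fixes A :: "real^'n::finite^'n"
  shows "det A = 0 \<longleftrightarrow> (\<exists>x. x \<noteq> 0 \<and> A *v x = 0)"
  using invertible_det_nz[of A] unfolding invertible_left_inverse matrix_left_invertible_ker by blast

text \<open>
  Two nodes are demanded because a single node without self-loops is strongly connected with
  out-degree 0, where the recursion would divide by 0.
\<close>

locale strong_digraph =
  fixes G :: "'n::finite pair_pre_digraph"
  assumes path: "(u, v) \<in> (parcs G)\<^sup>*"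
    and two_nodes: "CARD('n) \<ge> 2"
begin

lemma out_deg_pos: "out_deg G i > 0"
proof -
  obtain j where "j \<noteq> i"
    using two_nodes by (metis (full_types) UNIV_eq_I card_1_singleton_iff One_nat_def
        Suc_1 not_less_eq_eq order_refl singleton_iff)
  then obtain l where "(i, l) \<in> parcs G"
    using path[of i j] by (metis converse_rtranclE)
  then have "out_nbrs G i \<noteq> {}" by (auto simp: out_nbrs_def)
  then show ?thesis by (simp add: out_deg_def card_gt_0_iff)
qed

lemma in_nbrs_card_le: "card (in_nbrs G i) \<le> CARD('n)"
  by (rule card_mono) auto

lemma out_deg_le: "out_deg G i \<le> CARD('n)"
  unfolding out_deg_def by (rule card_mono) auto

text \<open>
  Double counting of the arcs.  It says that the column sums of the Laplacian vanish, and that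
  shipping along arcs conserves the total.
\<close>

lemma sum_in_nbrs:
  fixes f :: "'n \<Rightarrow> real"
  shows "(\<Sum>i\<in>UNIV. \<Sum>j\<in>in_nbrs G i. f j) = (\<Sum>j\<in>UNIV. real (out_deg G j) * f j)"
proof -
  have "(\<Sum>i\<in>UNIV. \<Sum>j\<in>in_nbrs G i. f j) = (\<Sum>j\<in>UNIV. \<Sum>i\<in>out_nbrs G j. f j)"
    using sum.swap_restrict[of UNIV UNIV "\<lambda>i j. f j" "\<lambda>i j. (j, i) \<in> parcs G"]
    by (simp add: in_nbrs_def out_nbrs_def)
  then show ?thesis by (simp add: out_deg_def)
qed

lemma bounded_paths: "\<exists>L. \<forall>u v. \<exists>l\<le>L. (u, v) \<in> parcs G ^^ l"
proof -
  have "(parcs G)\<^sup>* = (\<Union>n\<in>{n. n \<le> card (parcs G)}. parcs G ^^ n)"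
    by (rule rtrancl_finite_eq_relpow) simp
  then show ?thesis using path by blast
qed

text \<open>
  The kernel of the Laplacian as a balance condition at each node; functions are handier than
  vectors here, because \<open>h\<close> and its bounds are used one node at a time.
\<close>

definition harmonic :: "('n \<Rightarrow> real) \<Rightarrow> bool" where
  "harmonic v \<longleftrightarrow> (\<forall>i. real (out_deg G i) * v i = (\<Sum>j\<in>in_nbrs G i. v j))"

lemma harmonic_scale: "harmonic v \<Longrightarrow> harmonic (\<lambda>i. c * v i)"
  unfolding harmonic_def by (simp add: sum_distrib_left[symmetric] mult.left_commute)

lemma harmonic_diff: "harmonic u \<Longrightarrow> harmonic v \<Longrightarrow> harmonic (\<lambda>i. u i - v i)"
  unfolding harmonic_def by (simp add: sum_subtractf right_diff_distrib)

text \<open>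
  The minimum principle: at a zero the sum over the in-neighbours vanishes, so zeros propagate
  backwards along arcs and by strong connectivity reach every node.
\<close>

lemma harmonic_zero_spreads:
  assumes h: "harmonic v" and nn: "\<And>i. v i \<ge> 0" and z: "v i = 0"
  shows "v j = 0"
  using path[of j i]
proof (induction rule: converse_rtrancl_induct)
  case base
  show ?case by (rule z)
next
  case (step u w)
  then have "(\<Sum>j\<in>in_nbrs G w. v j) = 0" using h by (metis harmonic_def mult_zero_right)
  then show ?case using step(1) nn by (subst (asm) sum_nonneg_eq_0_iff) (auto simp: in_nbrs_def)
qed

text \<open>
  Subtracting the largest multiple of \<open>v\<close> that lies below \<open>w\<close> leaves a nonnegative harmonic
  function with a zero.
\<close>

lemma harmonic_unique:
  assumes v: "harmonic v" "\<And>i. v i > 0" and w: "harmonic w"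
  obtains c where "\<And>i. w i = c * v i"
proof -
  define c where "c = Min (range (\<lambda>i. w i / v i))"
  have "c \<in> range (\<lambda>i. w i / v i)" unfolding c_def by (rule Min_in) auto
  then obtain i where i: "c = w i / v i" by blast
  have "c \<le> w j / v j" for j unfolding c_def by (rule Min_le) auto
  then have nn: "w j - c * v j \<ge> 0" for j
    using v(2)[of j] by (metis diff_ge_0_iff_ge pos_le_divide_eq)
  have "w i - c * v i = 0" using i v(2)[of i] by simp
  then have "w j - c * v j = 0" for j
    using harmonic_zero_spreads[OF harmonic_diff[OF w harmonic_scale[OF v(1)]], of c i j] nn by blast
  then show thesis using that[of c] by simp
qed

text \<open>
  The triangle inequality gives \<open>d\<^sub>i \<bar>v\<^sub>i\<bar> \<le> \<Sum>\<^sub>j \<bar>v\<^sub>j\<bar>\<close> at each node.  Summed over all nodes both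
  sides are equal by double counting, so no single inequality is strict.
\<close>

lemma harmonic_abs:
  assumes h: "harmonic v"
  shows "harmonic (\<lambda>i. \<bar>v i\<bar>)"
proof -
  define e where "e i = (\<Sum>j\<in>in_nbrs G i. \<bar>v j\<bar>) - real (out_deg G i) * \<bar>v i\<bar>" for i
  have "real (out_deg G i) * \<bar>v i\<bar> = \<bar>\<Sum>j\<in>in_nbrs G i. v j\<bar>" for i
    using h by (simp add: harmonic_def abs_mult flip: h[unfolded harmonic_def, rule_format])
  then have "e i \<ge> 0" for i by (simp add: e_def sum_abs)
  moreover have "(\<Sum>i\<in>UNIV. e i) = 0" by (simp add: e_def sum_subtractf sum_in_nbrs)
  ultimately have "e i = 0" for i by (simp add: sum_nonneg_eq_0_iff)
  then show ?thesis by (simp add: harmonic_def e_def)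
qed

text \<open>
  If all arcs leaving \<open>j\<close> carry the weight \<open>u\<^sub>j\<close>, the balance of the weight matrix is the negative
  Laplacian of \<open>u\<close>.  It serves for the iterates as well as for their limit.
\<close>

lemma out_weight_balance:
  assumes "\<And>i j. M $ i $ j = (if (j, i) \<in> parcs G then u j else 0)"
  shows "((M - transpose M) *v vec 1) $ i
    = (\<Sum>j\<in>in_nbrs G i. u j) - real (out_deg G i) * u i"
proof -
  have "((M - transpose M) *v vec 1) $ i = (\<Sum>j\<in>UNIV. (if j \<in> in_nbrs G i then u j else 0)
      - (if j \<in> out_nbrs G i then u i else 0))"
    by (auto simp: matrix_vector_mult_def transpose_def assms in_nbrs_def out_nbrs_def
        intro!: sum.cong)
  then show ?thesis by (simp add: sum_subtractf sum.If_cases out_deg_def)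
qed

lemma laplacian_kernel_iff:
  assumes "init_assumption G A0"
  shows "laplacian_out G A0 *v v = 0 \<longleftrightarrow> harmonic (($) v)"
proof -
  have "(laplacian_out G A0 *v v) $ i =
      real (out_deg G i) * v $ i - (\<Sum>j\<in>in_nbrs G i. v $ j)" for i
  proof -
    have "(laplacian_out G A0 *v v) $ i =
       (\<Sum>j\<in>UNIV. (if i = j then real (out_deg G i) * v $ j else 0)
          - (if j \<in> in_nbrs G i then v $ j else 0))"
      unfolding matrix_vector_mult_def laplacian_out_def
      using assms by (auto simp: init_assumption_def in_nbrs_def left_diff_distrib intro!: sum.cong)
    then show ?thesis by (simp add: sum_subtractf sum.If_cases)
  qed
  then show ?thesis by (simp add: vec_eq_iff harmonic_def)
qed

text \<open>
  The Laplacian is singular because its columns sum to 0.  Any nonzero kernel vector may be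
  replaced by its absolute value, which has no zero by the minimum principle.
\<close>

lemma positive_harmonic_exists:
  obtains v where "harmonic v" "\<And>i. v i > 0"
proof -
  define A0 :: "real^'n^'n" where "A0 = (\<chi> i j. if (j, i) \<in> parcs G then 1 else 0)"
  have init: "init_assumption G A0" by (simp add: init_assumption_def A0_def)
  define L where "L = laplacian_out G A0"
  have "transpose L *v vec 1 = 0"
  proof -
    have "(transpose L *v vec 1) $ j = 0" for j
    proof -
      have "(transpose L *v vec 1) $ j =
        (\<Sum>i\<in>UNIV. (if i = j then real (out_deg G i) else 0) - (if i \<in> out_nbrs G j then 1 else 0))"
        by (auto simp: matrix_vector_mult_def transpose_def L_def laplacian_out_def A0_def
            out_nbrs_def intro!: sum.cong)
      then show ?thesis by (simp add: sum_subtractf sum.If_cases out_deg_def)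
    qed
    then show ?thesis by (simp add: vec_eq_iff)
  qed
  moreover have "vec 1 \<noteq> (0 :: real^'n)" by (simp add: vec_eq_iff)
  ultimately have "det (transpose L) = 0" using det_zero_iff_kernel by blast
  then have "det L = 0" by (simp add: det_transpose)
  then obtain v where v: "v \<noteq> 0" "L *v v = 0" using det_zero_iff_kernel by blast
  have h: "harmonic (\<lambda>i. \<bar>v $ i\<bar>)"
    using harmonic_abs v(2) laplacian_kernel_iff[OF init] by (simp add: L_def)
  obtain i where "v $ i \<noteq> 0" using v(1) by (auto simp: vec_eq_iff)
  then have "v $ j \<noteq> 0" for j using harmonic_zero_spreads[OF h, of j i] by auto
  then show thesis using that[OF h] by simp
qed

text \<open>
  For a functional \<open>F\<close> such as \<open>Max\<close> or \<open>Min\<close> that selects an element and is positively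
  homogeneous, exactly one vector on the ray of positive kernel vectors has value 1.  This makes
  the definite descriptions \<open>a_m\<close> and \<open>a_M\<close> meaningful.
\<close>

lemma kernel_normalized:
  fixes F :: "real set \<Rightarrow> real"
  assumes init: "init_assumption G A0"
    and F_in: "\<And>S. finite S \<Longrightarrow> S \<noteq> {} \<Longrightarrow> F S \<in> S"
    and F_scale: "\<And>S c. finite S \<Longrightarrow> S \<noteq> {} \<Longrightarrow> 0 < c \<Longrightarrow> F ((*) c ` S) = c * F S"
  shows "\<exists>!v. laplacian_out G A0 *v v = 0 \<and> (\<forall>i. 0 < v $ i) \<and> F (range (($) v)) = 1"
proof -
  obtain v where v: "harmonic v" "\<And>i. v i > 0" by (rule positive_harmonic_exists) blast
  have F_mult: "F (range (\<lambda>i. c * v i)) = c * F (range v)" if "c > 0" for c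
    using F_scale[of "range v" c] that by (simp add: image_image)
  have pos: "F (range v) > 0"
    using F_in[of "range v"] v(2) by auto
  show ?thesis
  proof (rule ex1I[of _ "\<chi> i. 1 / F (range v) * v i"])
    have "harmonic (($) (\<chi> i. 1 / F (range v) * v i))"
      using harmonic_scale[OF v(1), of "1 / F (range v)"] by (simp add: harmonic_def)
    moreover have "range (($) (\<chi> i. 1 / F (range v) * v i)) = range (\<lambda>i. 1 / F (range v) * v i)"
      by (intro image_cong) auto
    ultimately show "laplacian_out G A0 *v (\<chi> i. 1 / F (range v) * v i) = 0 \<and>
        (\<forall>i. 0 < (\<chi> i. 1 / F (range v) * v i) $ i) \<and>
        F (range (($) (\<chi> i. 1 / F (range v) * v i))) = 1"
      using F_mult[of "1 / F (range v)"] pos v(2) laplacian_kernel_iff[OF init] by simp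
  next
    fix w assume w: "laplacian_out G A0 *v w = 0 \<and> (\<forall>i. 0 < w $ i) \<and> F (range (($) w)) = 1"
    then obtain c where c: "\<And>i. w $ i = c * v i"
      using harmonic_unique[OF v] laplacian_kernel_iff[OF init] by metis
    then have "c > 0" using w v(2) by (metis zero_less_mult_pos2)
    then have "c * F (range v) = 1" using F_mult[of c] w c by simp
    then have "c = 1 / F (range v)" using pos by (simp add: field_simps)
    then show "w = (\<chi> i. 1 / F (range v) * v i)" using c by (simp add: vec_eq_iff)
  qed
qed

lemma a_m_spec:
  assumes "init_assumption G A0"
  shows "harmonic (($) (a_m G A0))" "0 < a_m G A0 $ i" "Max (range (($) (a_m G A0))) = 1"
proof -
  have "Max ((*) c ` S) = c * Max S" if "finite S" "S \<noteq> {}" "0 < c" for S and c :: real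
    using mono_Max_commute[of "(*) c" S] that by (simp add: mono_def)
  then have "\<exists>!v. laplacian_out G A0 *v v = 0 \<and> (\<forall>i. 0 < v $ i) \<and> Max (range (($) v)) = 1"
    using kernel_normalized[OF assms, of Max] by simp
  from theI'[OF this, folded a_m_def] show "harmonic (($) (a_m G A0))" "0 < a_m G A0 $ i"
      "Max (range (($) (a_m G A0))) = 1"
    by (auto simp: laplacian_kernel_iff[OF assms])
qed

lemma a_M_spec:
  assumes "init_assumption G A0"
  shows "harmonic (($) (a_M G A0))" "0 < a_M G A0 $ i" "Min (range (($) (a_M G A0))) = 1"
proof -
  have "Min ((*) c ` S) = c * Min S" if "finite S" "S \<noteq> {}" "0 < c" for S and c :: real
    using mono_Min_commute[of "(*) c" S] that by (simp add: mono_def)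
  then have "\<exists>!v. laplacian_out G A0 *v v = 0 \<and> (\<forall>i. 0 < v $ i) \<and> Min (range (($) v)) = 1"
    using kernel_normalized[OF assms, of Min] by simp
  from theI'[OF this, folded a_M_def] show "harmonic (($) (a_M G A0))" "0 < a_M G A0 $ i"
      "Min (range (($) (a_M G A0))) = 1"
    by (auto simp: laplacian_kernel_iff[OF assms])
qed

end

section \<open>Barriers and conservation of balance\<close>

text \<open>
  Here \<open>x t i\<close> is the amount that node \<open>i\<close> ships along each of its outgoing arcs at time \<open>t\<close>, and
  \<open>active t\<close> says that bits are available.  The rules for positive and for negative balances
  are symmetric except for \<open>x_full\<close>, since the rate argument traces the positive balance.
\<close>

locale balancing = strong_digraph G
  for G :: "'n::finite pair_pre_digraph" +
  fixes h b x :: "nat \<Rightarrow> 'n \<Rightarrow> real" and \<gamma> :: "nat \<Rightarrow> real" and active :: "nat \<Rightarrow> bool"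
  assumes h_Suc: "h (Suc t) i = h t i + x t i"
    and b_eq: "b t i = (\<Sum>j\<in>in_nbrs G i. h t j) - real (out_deg G i) * h t i"
    and x_pos: "0 \<le> b t i \<Longrightarrow> 0 \<le> x t i \<and> real (out_deg G i) * x t i \<le> b t i"
    and x_neg: "b t i \<le> 0 \<Longrightarrow> x t i \<le> 0 \<and> b t i \<le> real (out_deg G i) * x t i"
    and x_bound: "\<bar>x t i\<bar> \<le> \<gamma> t"
    and x_full: "active t \<Longrightarrow> real (out_deg G i) * \<gamma> t < b t i \<Longrightarrow> x t i = \<gamma> t"
    and x_idle: "\<not> active t \<Longrightarrow> x t i = 0"
begin

lemma gamma_nonneg: "0 \<le> \<gamma> t"
  using x_bound[of t] by (metis abs_ge_zero order_trans)

lemma b_Suc: "b (Suc t) i = b t i - real (out_deg G i) * x t i + (\<Sum>j\<in>in_nbrs G i. x t j)"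
  by (simp add: b_eq h_Suc sum.distrib algebra_simps)

lemma sum_b: "(\<Sum>i\<in>UNIV. b t i) = 0"
  by (simp add: b_eq sum_subtractf sum_in_nbrs)

text \<open>
  Only nodes with positive balance increase, and even shipping the whole balance would raise
  \<open>d\<^sub>i h\<^sub>i\<close> just to the sum of \<open>h\<close> over the in-neighbours, which is at most \<open>d\<^sub>i w\<^sub>i\<close>.
\<close>

lemma upper_barrier:
  assumes w: "harmonic w" and k: "\<And>i. h k i \<le> w i" and "k \<le> t"
  shows "h t i \<le> w i"
  using \<open>k \<le> t\<close>
proof (induction t arbitrary: i rule: dec_induct)
  case (step t)
  show ?case
  proof (cases "b t i \<le> 0")
    case True
    then show ?thesis using step.IH[of i] x_neg[of t i] by (simp add: h_Suc)
  next
    case False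
    then have "real (out_deg G i) * h (Suc t) i \<le> real (out_deg G i) * h t i + b t i"
      using x_pos[of t i] by (simp add: h_Suc algebra_simps)
    also have "\<dots> = (\<Sum>j\<in>in_nbrs G i. h t j)" by (simp add: b_eq)
    also have "\<dots> \<le> (\<Sum>j\<in>in_nbrs G i. w j)" by (intro sum_mono step.IH)
    also have "\<dots> = real (out_deg G i) * w i" using w by (simp add: harmonic_def)
    finally show ?thesis using out_deg_pos[of i] by simp
  qed
qed (rule k)

lemma lower_barrier:
  assumes w: "harmonic w" and k: "\<And>i. w i \<le> h k i" and "k \<le> t"
  shows "w i \<le> h t i"
  using \<open>k \<le> t\<close>
proof (induction t arbitrary: i rule: dec_induct)
  case (step t)
  show ?case
  proof (cases "b t i \<ge> 0")
    case True
    then show ?thesis using step.IH[of i] x_pos[of t i] by (simp add: h_Suc)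
  next
    case False
    have "real (out_deg G i) * w i = (\<Sum>j\<in>in_nbrs G i. w j)" using w by (simp add: harmonic_def)
    also have "\<dots> \<le> (\<Sum>j\<in>in_nbrs G i. h t j)" by (intro sum_mono step.IH)
    also have "\<dots> = real (out_deg G i) * h t i + b t i" by (simp add: b_eq)
    also have "\<dots> \<le> real (out_deg G i) * h (Suc t) i"
      using x_neg[of t i] False by (simp add: h_Suc algebra_simps)
    finally show ?thesis using out_deg_pos[of i] by simp
  qed
qed (rule k)

definition imbalance :: "nat \<Rightarrow> real" where
  "imbalance t = (\<Sum>i\<in>UNIV. \<bar>b t i\<bar>)"

text \<open>
  The positive balance annihilated at node \<open>i\<close> in step \<open>t\<close>: what was there, minus what was shipped,
  plus the positive amounts received, minus what is there afterwards.
\<close>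

definition loss :: "nat \<Rightarrow> 'n \<Rightarrow> real" where
  "loss t i = max 0 (b t i) - real (out_deg G i) * max 0 (x t i)
     + (\<Sum>j\<in>in_nbrs G i. max 0 (x t j)) - max 0 (b (Suc t) i)"

text \<open>
  As the balances sum to 0, their positive and negative parts have the same total.
\<close>

lemma imbalance_eq_pos: "imbalance t = 2 * (\<Sum>i\<in>UNIV. max 0 (b t i))"
proof -
  have "imbalance t = (\<Sum>i\<in>UNIV. 2 * max 0 (b t i) - b t i)"
    unfolding imbalance_def by (intro sum.cong) auto
  then show ?thesis by (simp add: sum_subtractf sum_b sum_distrib_left)
qed

lemma imbalance_eq_neg: "imbalance t = 2 * (\<Sum>i\<in>UNIV. max 0 (- b t i))"
proof -
  have "imbalance t = (\<Sum>i\<in>UNIV. 2 * max 0 (- b t i) + b t i)"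
    unfolding imbalance_def by (intro sum.cong) auto
  then show ?thesis by (simp add: sum.distrib sum_b sum_distrib_left)
qed

text \<open>
  A node does not overshoot its balance, so shipping commutes with taking positive parts;
  afterwards, negative amounts received can only diminish the positive part.
\<close>

lemma loss_nonneg: "0 \<le> loss t i"
proof -
  have keep: "max 0 (b t i - real (out_deg G i) * x t i)
      = max 0 (b t i) - real (out_deg G i) * max 0 (x t i)"
    using x_pos[of t i] x_neg[of t i] by (cases "b t i \<ge> 0") (auto simp: max_def)
  have "b (Suc t) i \<le> (b t i - real (out_deg G i) * x t i) + (\<Sum>j\<in>in_nbrs G i. max 0 (x t j))"
    unfolding b_Suc by (intro add_left_mono sum_mono) auto
  moreover have "0 \<le> (\<Sum>j\<in>in_nbrs G i. max 0 (x t j))" by (intro sum_nonneg) auto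
  ultimately show ?thesis unfolding loss_def keep[symmetric] by linarith
qed

lemma imbalance_drop: "imbalance t - imbalance (Suc t) = 2 * (\<Sum>i\<in>UNIV. loss t i)"
  by (simp add: imbalance_eq_pos loss_def sum.distrib sum_subtractf sum_in_nbrs)

lemma imbalance_antimono: "s \<le> t \<Longrightarrow> imbalance t \<le> imbalance s"
proof (rule lift_Suc_antimono_le[of imbalance])
  show "imbalance (Suc t) \<le> imbalance t" for t
    using imbalance_drop[of t] sum_nonneg[of UNIV "loss t"] loss_nonneg by simp
qed

lemma imbalance_drop_window: "imbalance k - imbalance (k + p) = 2 * (\<Sum>s<p. \<Sum>i\<in>UNIV. loss (k + s) i)"
proof (induction p)
  case (Suc p)
  then show ?case using imbalance_drop[of "k + p"] by simp
qed simp

section \<open>Flow of positive balance through the graph\<close>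

definition flow :: "nat \<Rightarrow> 'n \<Rightarrow> nat \<Rightarrow> real" where
  "flow k i p = (\<Sum>s<p. max 0 (x (k + s) i))"

lemma flow_nonneg: "0 \<le> flow k i p"
  unfolding flow_def by (intro sum_nonneg) auto

lemma flow_balance:
  "max 0 (b (k + p) m) + real (out_deg G m) * flow k m p + (\<Sum>s<p. loss (k + s) m)
    = max 0 (b k m) + (\<Sum>j\<in>in_nbrs G m. flow k j p)"
proof (induction p)
  case (Suc p)
  then show ?case by (simp add: flow_def loss_def sum.distrib algebra_simps)
qed (simp add: flow_def)

lemma b_change: "\<bar>b (Suc t) i - b t i\<bar> \<le> 2 * real CARD('n) * \<gamma> t"
proof -
  have "\<bar>real (out_deg G i) * x t i\<bar> \<le> real CARD('n) * \<gamma> t"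
    unfolding abs_mult using out_deg_le[of i] x_bound[of t i] by (intro mult_mono) auto
  moreover have "\<bar>\<Sum>j\<in>in_nbrs G i. x t j\<bar> \<le> real (card (in_nbrs G i)) * \<gamma> t"
    using x_bound[of t] by (intro order_trans[OF sum_abs] sum_bounded_above) auto
  moreover have "real (card (in_nbrs G i)) * \<gamma> t \<le> real CARD('n) * \<gamma> t"
    using in_nbrs_card_le[of i] gamma_nonneg[of t] by (intro mult_right_mono) auto
  ultimately show ?thesis unfolding b_Suc by linarith
qed

lemma b_change_window:
  assumes "\<And>s. s < p \<Longrightarrow> \<gamma> (k + s) \<le> gmax"
  shows "\<bar>b (k + p) i - b k i\<bar> \<le> 2 * real CARD('n) * gmax * real p"
  using assms
proof (induction p)
  case (Suc p)
  have "2 * real CARD('n) * \<gamma> (k + p) \<le> 2 * real CARD('n) * gmax"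
    using Suc.prems[of p] by (intro mult_left_mono) auto
  then have "\<bar>b (k + Suc p) i - b (k + p) i\<bar> \<le> 2 * real CARD('n) * gmax"
    using b_change[of "k + p" i] by (simp only: add_Suc_right)
  moreover have "\<bar>b (k + p) i - b k i\<bar> \<le> 2 * real CARD('n) * gmax * real p"
    using Suc by simp
  ultimately show ?case by (simp add: algebra_simps)
qed simp

text \<open>
  What node \<open>j\<close> sends to \<open>m\<close> is passed on by \<open>m\<close>, up to annihilation and a bounded deposit.  In
  the induction on time there are two cases.  If \<open>m\<close> is below the threshold \<open>N \<gamma>\<^sub>m\<^sub>a\<^sub>x\<close>, the
  deposit after the step is at most \<open>4 N \<gamma>\<^sub>m\<^sub>a\<^sub>x\<close> and conservation gives the claim directly, without
  the induction hypothesis.  If \<open>m\<close> is above it, \<open>m\<close> ships at full rate, hence at least as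
  much as \<open>j\<close> does in this step, whatever the size of the deposit.
\<close>

lemma flow_arc:
  assumes arc: "(j, m) \<in> parcs G" and g: "\<And>s. s < p \<Longrightarrow> \<gamma> (k + s) \<le> gmax"
    and g0: "0 \<le> gmax"
  shows "flow k j p \<le> real CARD('n) * flow k m p + (\<Sum>s<p. loss (k + s) m)
           + 4 * real CARD('n) * gmax"
  using g
proof (induction p)
  case 0
  show ?case using g0 by (simp add: flow_def)
next
  case (Suc p)
  let ?N = "real CARD('n)"
  have gp: "\<gamma> (k + p) \<le> gmax" using Suc.prems by simp
  show ?case
  proof (cases "b (k + p) m \<le> ?N * gmax")
    case True
    have "?N * \<gamma> (k + p) \<le> ?N * gmax" using gp by (intro mult_left_mono) auto
    then have "b (k + Suc p) m \<le> 4 * ?N * gmax"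
      using b_change[of "k + p" m] True unfolding add_Suc_right abs_le_iff by linarith
    then have "max 0 (b (k + Suc p) m) \<le> 4 * ?N * gmax" using g0 by simp
    moreover have "real (out_deg G m) * flow k m (Suc p) \<le> ?N * flow k m (Suc p)"
      using out_deg_le[of m] flow_nonneg by (intro mult_right_mono) auto
    moreover have "flow k j (Suc p) \<le> (\<Sum>j\<in>in_nbrs G m. flow k j (Suc p))"
      using arc flow_nonneg by (intro member_le_sum) (auto simp: in_nbrs_def)
    ultimately show ?thesis using flow_balance[of k "Suc p" m] by linarith
  next
    case False
    have "real (out_deg G m) * \<gamma> (k + p) \<le> ?N * gmax"
      using out_deg_le[of m] gp gamma_nonneg by (intro mult_mono) auto
    then have full: "active (k + p) \<Longrightarrow> x (k + p) m = \<gamma> (k + p)"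
      using False by (intro x_full) auto
    have "max 0 (x (k + p) j) \<le> max 0 (x (k + p) m)"
    proof (cases "active (k + p)")
      case True
      then show ?thesis using full x_bound[of "k + p" j] gamma_nonneg[of "k + p"] by (simp add: abs_le_iff)
    qed (simp add: x_idle)
    also have "\<dots> \<le> ?N * max 0 (x (k + p) m)"
      using two_nodes by (simp add: mult_le_cancel_right1)
    finally have "flow k j (Suc p) \<le> flow k j p + ?N * max 0 (x (k + p) m)"
      by (simp add: flow_def)
    moreover have "flow k j p \<le> ?N * flow k m p + (\<Sum>s<p. loss (k + s) m) + 4 * ?N * gmax"
      using Suc by simp
    moreover have "?N * flow k m (Suc p) = ?N * flow k m p + ?N * max 0 (x (k + p) m)"
      by (simp add: flow_def algebra_simps)
    moreover have "(\<Sum>s<Suc p. loss (k + s) m) \<ge> (\<Sum>s<p. loss (k + s) m)"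
      using loss_nonneg by simp
    ultimately show ?thesis by linarith
  qed
qed

text \<open>
  Iterating \<open>flow_arc\<close> along a path of length \<open>l\<close>.  The loss at one node is bounded by
  the loss of the whole graph, which is half the drop of the norm.
\<close>

lemma flow_path:
  assumes g: "\<And>s. s < p \<Longrightarrow> \<gamma> (k + s) \<le> gmax" and "0 \<le> gmax"
    and R: "(i, m) \<in> parcs G ^^ l"
  defines "K \<equiv> (imbalance k - imbalance (k + p)) / 2 + 4 * real CARD('n) * gmax"
  shows "flow k i p \<le> real CARD('n) ^ l * (flow k m p + real l * K)"
  using R
proof (induction l arbitrary: m)
  case (Suc l)
  let ?N = "real CARD('n)"
  from Suc.prems obtain j where j: "(i, j) \<in> parcs G ^^ l" "(j, m) \<in> parcs G" by auto
  have N: "1 \<le> ?N" using two_nodes by simp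
  have K: "0 \<le> K" using imbalance_antimono[of k "k + p"] \<open>0 \<le> gmax\<close> by (simp add: K_def)
  have "(\<Sum>s<p. loss (k + s) m) \<le> (\<Sum>s<p. \<Sum>i\<in>UNIV. loss (k + s) i)"
    using loss_nonneg by (intro sum_mono member_le_sum) auto
  then have "flow k j p \<le> ?N * flow k m p + K"
    using flow_arc[OF j(2) g, of p] \<open>0 \<le> gmax\<close> imbalance_drop_window[of k p] by (simp add: K_def)
  moreover have "(real l + 1) * K \<le> ?N * ((real l + 1) * K)"
    using mult_right_mono[OF N, of "(real l + 1) * K"] K by simp
  ultimately have "flow k j p + real l * K \<le> ?N * (flow k m p + real (Suc l) * K)"
    by (simp add: algebra_simps)
  then have "?N ^ l * (flow k j p + real l * K) \<le> ?N ^ l * (?N * (flow k m p + real (Suc l) * K))"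
    by (intro mult_left_mono) auto
  then show ?case using order_trans[OF Suc.IH[OF j(1)]] unfolding power_Suc2 mult.assoc by blast
qed simp

text \<open>
  The window is long enough (\<open>T\<close>) for the emission of a saturated node to reach any other
  node.  The threshold \<open>C\<close> in the proof is the saturation threshold plus the largest possible
  change during the window, so a node above \<open>C\<close> stays saturated and a node below \<open>-C\<close> stays
  negative.  If there are not both such nodes, the norm itself is of order \<open>g\<close>, since its positive
  and negative parts are equally large.  The step-size may vary in the window by the factor \<open>\<rho>\<close>.
\<close>

lemma window_decay:
  fixes g \<rho> T :: real
  assumes g: "\<And>s. s < p \<Longrightarrow> g \<le> \<gamma> (k + s)" "\<And>s. s < p \<Longrightarrow> \<gamma> (k + s) \<le> \<rho> * g"
    and pos: "0 < g" "0 < \<rho>"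
    and L: "\<forall>u v. \<exists>l\<le>L. (u, v) \<in> parcs G ^^ l"
    and T: "real CARD('n) ^ L * (real L * (1 + 4 * real CARD('n) * \<rho>)) < T"
    and act: "T \<le> real (card {s. s < p \<and> active (k + s)})"
  shows "imbalance (k + p) \<le> imbalance k - 2 * g \<or>
    imbalance k \<le> 2 * (real CARD('n) * (real CARD('n) * \<rho> * (2 * real p + 1))) * g"
proof -
  let ?N = "real CARD('n)"
  define C where "C = ?N * \<rho> * (2 * real p + 1) * g"
  have C: "C = ?N * (\<rho> * g) + 2 * ?N * (\<rho> * g) * real p" by (simp add: C_def algebra_simps)
  have C0: "0 \<le> C" using pos by (simp add: C_def)
  consider "\<forall>i. b k i \<le> C" | "\<forall>i. - C \<le> b k i" | i j where "b k i > C" "b k j < - C"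
    by (meson not_less)
  then show ?thesis
  proof cases
    case 1
    then have "(\<Sum>i\<in>UNIV. max 0 (b k i)) \<le> ?N * C"
      using C0 by (intro sum_bounded_above) auto
    then show ?thesis unfolding imbalance_eq_pos C_def by (simp add: mult.assoc)
  next
    case 2
    then have "max 0 (- b k i) \<le> C" for i
      using C0 2[rule_format, of i] by linarith
    then have "(\<Sum>i\<in>UNIV. max 0 (- b k i)) \<le> ?N * C"
      by (intro sum_bounded_above)
    then show ?thesis unfolding imbalance_eq_neg[of k] C_def by (simp add: mult.assoc)
  next
    case 3
    have stay: "\<bar>b (k + s) m - b k m\<bar> \<le> 2 * ?N * (\<rho> * g) * real p" if "s < p" for s m
    proof -
      have "\<bar>b (k + s) m - b k m\<bar> \<le> 2 * ?N * (\<rho> * g) * real s"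
        using that g(2) by (intro b_change_window) auto
      also have "\<dots> \<le> 2 * ?N * (\<rho> * g) * real p" using that pos by (intro mult_left_mono) auto
      finally show ?thesis .
    qed
    have out: "g \<le> x (k + s) i" if "s < p" "active (k + s)" for s
    proof -
      have "real (out_deg G i) * \<gamma> (k + s) \<le> ?N * (\<rho> * g)"
        using out_deg_le[of i] g(2)[OF that(1)] gamma_nonneg by (intro mult_mono) auto
      then have "x (k + s) i = \<gamma> (k + s)"
        using 3(1) stay[OF that(1), of i] that(2) C by (intro x_full) auto
      then show ?thesis using g(1)[OF that(1)] by simp
    qed
    have "T * g \<le> real (card {s. s < p \<and> active (k + s)}) * g"
      using act pos by (intro mult_right_mono) auto
    also have "\<dots> \<le> (\<Sum>s | s < p \<and> active (k + s). max 0 (x (k + s) i))"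
      using out by (intro sum_bounded_below) (auto simp: le_max_iff_disj)
    also have "\<dots> \<le> flow k i p"
      unfolding flow_def by (intro sum_mono2) auto
    finally have source: "T * g \<le> flow k i p" .
    have "x (k + s) j \<le> 0" if "s < p" for s
      using x_neg[of "k + s" j] stay[OF that, of j] 3(2) C pos
      by (smt (verit) mult_nonneg_nonneg of_nat_0_le_iff)
    then have sink: "flow k j p = 0" by (simp add: flow_def)
    obtain l where l: "l \<le> L" "(i, j) \<in> parcs G ^^ l" using L by blast
    define K where "K = (imbalance k - imbalance (k + p)) / 2 + 4 * ?N * (\<rho> * g)"
    have K0: "0 \<le> K" using imbalance_antimono[of k "k + p"] pos by (simp add: K_def)
    have "T * g \<le> ?N ^ l * (real l * K)"
      using flow_path[OF g(2) _ l(2)] sink source pos by (fastforce simp: K_def)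
    also have "\<dots> \<le> ?N ^ L * (real L * K)"
      using l(1) K0 two_nodes by (intro mult_mono power_increasing) auto
    finally have upper: "T * g \<le> ?N ^ L * (real L * K)" .
    have "g \<le> (imbalance k - imbalance (k + p)) / 2"
    proof (rule ccontr)
      assume "\<not> ?thesis"
      then have "K \<le> (1 + 4 * ?N * \<rho>) * g" by (simp add: K_def algebra_simps)
      then have "?N ^ L * (real L * K) \<le> ?N ^ L * (real L * ((1 + 4 * ?N * \<rho>) * g))"
        by (intro mult_left_mono) auto
      also have "\<dots> < T * g" using mult_strict_right_mono[OF T pos(1)] by (simp add: mult.assoc)
      finally show False using upper by simp
    qed
    then show ?thesis by simp
  qed
qed

end

section \<open>From decay on windows to the rate\<close>

text \<open>
  If \<open>U n > C/(n+1)\<close> held from some point on, \<open>U\<close> would lose a divergent harmonic series.  So the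
  bound holds at some late time; afterwards \<open>U n \<le> 2C/(n+1)\<close> persists, because for
  \<open>n \<ge> 2C/e\<close> the guaranteed drop \<open>e/(n+1)\<close> exceeds the decrease of \<open>2C/(n+1)\<close> in one step.
\<close>

lemma harmonic_decrease_bound:
  fixes U :: "nat \<Rightarrow> real"
  assumes mono: "\<And>n. U (Suc n) \<le> U n" and nn: "\<And>n. 0 \<le> U n" and e: "0 < e" and C: "0 \<le> C"
    and step: "\<And>n. n \<ge> 1 \<Longrightarrow> U (Suc n) \<le> U n - e / real (Suc n) \<or> U n \<le> C / real (Suc n)"
  obtains K where "\<And>n. U n \<le> K / real (Suc n)"
proof -
  obtain n0 where n0: "2 * C / e \<le> real n0" "1 \<le> n0"
    using real_arch_simple[of "max 1 (2 * C / e)"] by (metis max.bounded_iff of_nat_1 of_nat_le_iff)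
  have "\<exists>n\<ge>n0. U n \<le> C / real (Suc n)"
  proof (rule ccontr)
    assume "\<not> ?thesis"
    then have drop: "e / real (Suc n) \<le> U n - U (Suc n)" if "n \<ge> n0" for n
      using step[of n] n0(2) that by fastforce
    have "summable (\<lambda>n. U n - U (Suc n))"
    proof -
      have "decseq U" using mono by (simp add: decseq_Suc_iff)
      then obtain l where "U \<longlonglongrightarrow> l" using decseq_convergent nn by blast
      then show ?thesis by (rule telescope_summable')
    qed
    then have "summable (\<lambda>n. e / real (Suc n))"
      by (rule summable_comparison_test') (use drop e in auto)
    then have "summable (\<lambda>n. 1 / e * (e / real (Suc n)))" by (rule summable_mult)
    then have "summable (\<lambda>n. inverse (real (Suc n)))" using e by (simp add: field_simps)
    then show False using summable_Suc_iff[of "\<lambda>n. inverse (real n)"] not_summable_harmonic[where ?'a = real] by blast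
  qed
  then obtain n1 where n1: "n1 \<ge> n0" "U n1 \<le> C / real (Suc n1)" by blast
  \<comment> \<open>The factor 2 pays for replacing \<open>C/(n+1)\<close> by a multiple of \<open>1/(n+2)\<close>.\<close>
  have late: "U n \<le> 2 * C / real (Suc n)" if "n \<ge> n1" for n
    using that
  proof (induction n rule: dec_induct)
    case base
    have "C / real (Suc n1) \<le> 2 * C / real (Suc n1)" using C by (intro divide_right_mono) auto
    then show ?case using n1(2) by linarith
  next
    case (step n)
    have n: "n \<ge> n0" "n \<ge> 1" using step(1) n1(1) n0(2) by auto
    have n': "real (Suc n) > 0" "real (Suc (Suc n)) > 0" by auto
    show ?case using assms(5)[OF n(2)]
    proof
      assume *: "U (Suc n) \<le> U n - e / real (Suc n)"
      have "2 * C / e \<le> real n" using n0(1) n(1) by linarith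
      then have "2 * C \<le> e * real n" using e by (simp add: field_simps)
      also have "\<dots> \<le> e * real (Suc (Suc n))" using e by (intro mult_left_mono) auto
      finally have "(2 * C - e) * real (Suc (Suc n)) \<le> 2 * C * real (Suc n)"
        by (simp add: algebra_simps)
      then have "(2 * C - e) / real (Suc n) \<le> 2 * C / real (Suc (Suc n))"
        using n' by (simp add: pos_divide_le_eq pos_le_divide_eq)
      then show ?thesis using * step.IH by (simp add: diff_divide_distrib)
    next
      assume *: "U n \<le> C / real (Suc n)"
      have "C * real (Suc (Suc n)) \<le> C * (2 * real (Suc n))" using C by (intro mult_left_mono) auto
      then have "C / real (Suc n) \<le> 2 * C / real (Suc (Suc n))"
        using n' by (simp add: pos_divide_le_eq pos_le_divide_eq algebra_simps)
      then show ?thesis using * mono[of n] by linarith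
    qed
  qed
  define K where "K = max (2 * C) (U 0 * real (Suc n1))"
  have "U n \<le> K / real (Suc n)" for n
  proof (cases "n \<ge> n1")
    case True
    have "2 * C / real (Suc n) \<le> K / real (Suc n)" by (intro divide_right_mono) (auto simp: K_def)
    then show ?thesis using late[OF True] by linarith
  next
    case False
    have "U n * real (Suc n) \<le> U 0 * real (Suc n1)"
      using False nn lift_Suc_antimono_le[of U 0 n] mono by (intro mult_mono) auto
    then show ?thesis by (simp add: pos_le_divide_eq K_def)
  qed
  then show thesis by (rule that)
qed

text \<open>
  Windows consisting of \<open>T\<close> whole blocks of length \<open>W\<close> contain at least one active time per block.
\<close>

lemma card_active_window:
  assumes W: "0 < W" and act: "\<And>n. \<exists>t. n * W \<le> t \<and> t < Suc n * W \<and> active t"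
  shows "T \<le> card {s. s < T * W \<and> active (n * (T * W) + s)}"
proof -
  obtain f where f: "\<And>n. n * W \<le> f n \<and> f n < Suc n * W \<and> active (f n)" using act by metis
  \<comment> \<open>The offset in the window of an active time in its \<open>m\<close>-th block; dividing by \<open>W\<close> recovers \<open>m\<close>.\<close>
  define p where "p m = f (n * T + m) - n * (T * W)" for m
  have p: "n * (T * W) + p m = f (n * T + m)" "m * W \<le> p m" "p m < Suc m * W" for m
    using f[of "n * T + m"] by (auto simp: p_def algebra_simps)
  have d: "p m div W = m" for m
    using p(2,3)[of m] W by (intro div_nat_eqI) (auto simp: mult.commute)
  have "inj_on p {..<T}" by (rule inj_on_inverseI[where g = "\<lambda>q. q div W"]) (rule d)
  moreover have "p ` {..<T} \<subseteq> {s. s < T * W \<and> active (n * (T * W) + s)}"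
  proof clarsimp
    fix m assume "m < T"
    then have "Suc m * W \<le> T * W" by (intro mult_right_mono) auto
    then show "p m < T * W \<and> active (n * (T * W) + p m)"
      using p[of m] f[of "n * T + m"] by simp
  qed
  ultimately have "card {..<T} \<le> card {s. s < T * W \<and> active (n * (T * W) + s)}"
    by (intro card_inj_on_le) auto
  then show ?thesis by simp
qed

context balancing
begin

text \<open>
  Windows have length \<open>p = T W\<close> and start at multiples of \<open>p\<close>.  From the second one on the step-size
  varies in a window at most by the factor \<open>2c'\<close>, a number that does not depend on \<open>p\<close>; so
  \<open>T\<close>, and with it \<open>p\<close>, can be chosen after this factor.
\<close>

lemma imbalance_bound:
  assumes W: "0 < W" and act: "\<And>n. \<exists>t. n * W \<le> t \<and> t < Suc n * W \<and> active t"
    and c: "0 < c" "0 < c'"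
    and g: "\<And>t. c / (real t + c) \<le> \<gamma> t" "\<And>t. \<gamma> t \<le> c' * c / (real t + c)"
  obtains K where "\<And>k. imbalance k \<le> K / real (Suc k)"
proof -
  let ?N = "real CARD('n)"
  define \<rho> where "\<rho> = 2 * c'"
  obtain L where L: "\<forall>u v. \<exists>l\<le>L. (u, v) \<in> parcs G ^^ l" using bounded_paths by blast
  obtain T where T: "?N ^ L * (real L * (1 + 4 * ?N * \<rho>)) < real T"
    using reals_Archimedean2 by blast
  have "0 \<le> ?N ^ L * (real L * (1 + 4 * ?N * \<rho>))" using c by (simp add: \<rho>_def)
  then have T0: "0 < T" using T by (metis of_nat_0_less_iff order_le_less_trans)
  define p where "p = T * W"
  have p0: "1 \<le> p" using T0 W by (simp add: p_def Suc_le_eq)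
  define D where "D = 2 * (?N * (?N * \<rho> * (2 * real p + 1)))"
  have D0: "0 \<le> D" using c by (simp add: D_def \<rho>_def)
  define U where "U n = imbalance (n * p)" for n
  have U: "U (Suc n) \<le> U n - (2 * c / (real p + c)) / real (Suc n) \<or>
      U n \<le> (D * c) / real (Suc n)" if n: "n \<ge> 1" for n
  proof -
    define q where "q = c / (real (n * p + p) + c)"
    have q0: "0 < q" using c by (simp add: q_def add_nonneg_pos)
    have np: "real p \<le> real (n * p)" using n by (cases n) auto
    have lo: "q \<le> \<gamma> (n * p + s)" if "s < p" for s
    proof -
      have "q \<le> c / (real (n * p + s) + c)"
        unfolding q_def using that c by (intro divide_left_mono) (auto intro!: mult_pos_pos add_nonneg_pos)
      then show ?thesis using g(1)[of "n * p + s"] by linarith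
    qed
    have hi: "\<gamma> (n * p + s) \<le> \<rho> * q" for s
    proof -
      have "c' * c / (real (n * p + s) + c) \<le> c' * c / ((real (n * p + p) + c) / 2)"
        using np c by (intro divide_left_mono) (auto intro!: mult_pos_pos add_nonneg_pos)
      also have "\<dots> = \<rho> * q" by (simp add: \<rho>_def q_def)
      finally show ?thesis using g(2)[of "n * p + s"] by linarith
    qed
    have "real T \<le> real (card {s. s < p \<and> active (n * p + s)})"
      using card_active_window[OF W act, of T n] by (simp add: p_def)
    then have dec: "U (Suc n) \<le> U n - 2 * q \<or> U n \<le> D * q"
      using window_decay[OF lo hi q0 _ L T] c
      by (simp add: U_def D_def \<rho>_def add.commute)
    have p1: "real p \<ge> 1" using p0 by simp
    have "real (n * p + p) + c \<le> (real p + c) * real (Suc n)"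
      using c by (simp add: algebra_simps)
    then have "c / ((real p + c) * real (Suc n)) \<le> q"
      unfolding q_def using c p1 n by (intro divide_left_mono) (auto intro!: mult_pos_pos add_nonneg_pos)
    then have ql: "(2 * c / (real p + c)) / real (Suc n) \<le> 2 * q" by simp
    have "real (Suc n) \<le> real p * real (Suc n)"
      using p1 by (simp add: mult_le_cancel_right1)
    then have "real (Suc n) \<le> real (n * p + p) + c" using c by (simp add: algebra_simps)
    then have "q \<le> c / real (Suc n)"
      unfolding q_def using c by (intro divide_left_mono) (auto intro!: mult_pos_pos add_nonneg_pos)
    then have "D * q \<le> D * (c / real (Suc n))" using D0 by (intro mult_left_mono) auto
    then show ?thesis using dec ql by auto
  qed
  have e0: "0 < 2 * c / (real p + c)" using c by (simp add: add_nonneg_pos)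
  have mono: "U (Suc n) \<le> U n" for n unfolding U_def by (intro imbalance_antimono) simp
  have nn: "0 \<le> U n" for n by (simp add: U_def imbalance_def sum_nonneg)
  have Dc: "0 \<le> D * c" using D0 c by simp
  obtain K where K: "\<And>n. U n \<le> K / real (Suc n)"
    using harmonic_decrease_bound[OF mono nn e0 Dc U] by blast
  have K0: "0 \<le> K" using K[of 0] nn[of 0] by simp
  have "imbalance k \<le> K * real p / real (Suc k)" for k
  proof -
    have "k div p * p \<le> k" by simp
    then have "imbalance k \<le> U (k div p)" unfolding U_def by (rule imbalance_antimono)
    also have "\<dots> \<le> K / real (Suc (k div p))" by (rule K)
    also have "\<dots> \<le> K * real p / real (Suc k)"
    proof -
      have "Suc k \<le> Suc (k div p) * p"
        using p0 dividend_less_div_times[of p k] by simp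
      then have "real (Suc k) \<le> real (Suc (k div p)) * real p"
        by (metis of_nat_le_iff of_nat_mult)
      then have "K * real (Suc k) \<le> K * (real (Suc (k div p)) * real p)"
        using K0 by (rule mult_left_mono)
      then show ?thesis
        by (simp add: pos_divide_le_eq pos_le_divide_eq mult.assoc mult.commute mult.left_commute)
    qed
    finally show ?thesis .
  qed
  then show thesis by (rule that)
qed

text \<open>
  The barriers turn convergence along a subsequence into convergence: once \<open>h\<close> is within
  \<open>d v\<close> of the limit point \<open>c v\<close>, it remains so.
\<close>

lemma h_converges:
  assumes imbalance_lim: "imbalance \<longlonglongrightarrow> 0"
  obtains w where "harmonic w" "\<And>i. (\<lambda>t. h t i) \<longlonglongrightarrow> w i"
proof -
  obtain v where v: "harmonic v" "\<And>i. v i > 0" by (rule positive_harmonic_exists) blast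
  define M where "M = (\<Sum>i\<in>UNIV. \<bar>h 0 i\<bar> / v i)"
  have M: "\<bar>h 0 i\<bar> \<le> M * v i" for i
  proof -
    have "\<bar>h 0 i\<bar> / v i \<le> M"
      unfolding M_def using v(2) by (intro member_le_sum) (auto intro!: divide_nonneg_pos)
    then show ?thesis using v(2)[of i] by (metis pos_divide_le_eq)
  qed
  have up: "h t i \<le> M * v i" for t i
  proof (rule upper_barrier[OF harmonic_scale[OF v(1)], of 0])
    show "h 0 j \<le> M * v j" for j by (rule abs_le_D1[OF M])
  qed simp
  have low: "- M * v i \<le> h t i" for t i
  proof (rule lower_barrier[OF harmonic_scale[OF v(1)], of "- M" 0])
    show "- M * v j \<le> h 0 j" for j using abs_le_D2[OF M[of j]] by simp
  qed simp
  have habs: "\<bar>h t i\<bar> \<le> M * v i" for t i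
    using up[of t i] low[of i t] by (intro abs_leI) auto
  define H :: "nat \<Rightarrow> real^'n" where "H t = (\<chi> i. h t i)" for t
  have "norm (H t) \<le> (\<Sum>i\<in>UNIV. M * v i)" for t
  proof -
    have "norm (H t) \<le> (\<Sum>i\<in>UNIV. \<bar>H t $ i\<bar>)" by (rule norm_le_l1_cart)
    also have "\<dots> \<le> (\<Sum>i\<in>UNIV. M * v i)"
      using habs by (intro sum_mono) (simp add: H_def)
    finally show ?thesis .
  qed
  then have "bounded (range H)" by (auto simp: bounded_iff)
  then obtain l r where r: "strict_mono r" "(H \<circ> r) \<longlonglongrightarrow> l"
    using bounded_imp_convergent_subsequence by blast
  have sub: "(\<lambda>t. h (r t) i) \<longlonglongrightarrow> l $ i" for i
    using tendsto_vec_nth[OF r(2), of i] by (simp add: H_def o_def)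
  have b0: "(\<lambda>t. b t i) \<longlonglongrightarrow> 0" for i
  proof (rule Lim_null_comparison[OF always_eventually imbalance_lim], rule allI)
    show "norm (b t i) \<le> imbalance t" for t
      unfolding imbalance_def real_norm_def by (rule member_le_sum) auto
  qed
  have "harmonic (($) l)"
    unfolding harmonic_def
  proof
    fix i
    have "(\<lambda>t. b (r t) i) \<longlonglongrightarrow> (\<Sum>j\<in>in_nbrs G i. l $ j) - real (out_deg G i) * l $ i"
      unfolding b_eq by (intro tendsto_intros sub)
    moreover have "(\<lambda>t. b (r t) i) \<longlonglongrightarrow> 0"
      using LIMSEQ_subseq_LIMSEQ[OF b0 r(1)] by (simp add: o_def)
    ultimately show "real (out_deg G i) * l $ i = (\<Sum>j\<in>in_nbrs G i. l $ j)"
      using LIMSEQ_unique by fastforce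
  qed
  then obtain c where c: "\<And>i. l $ i = c * v i" by (rule harmonic_unique[OF v]) blast
  have "(\<lambda>t. h t i) \<longlonglongrightarrow> c * v i" for i
  proof (rule LIMSEQ_I)
    fix e :: real assume e: "0 < e"
    \<comment> \<open>The width is chosen so that \<open>(c \<plusminus> d) v\<close> differ by \<open>e\<close> at node \<open>i\<close>.\<close>
    define d where "d = e / (2 * v i)"
    have d: "0 < d" using e v(2)[of i] by (simp add: d_def)
    have "\<forall>\<^sub>F t in sequentially. \<bar>h (r t) j - c * v j\<bar> < d * v j" for j
      using tendstoD[OF sub[of j], of "d * v j"] d v(2)[of j] by (simp add: c dist_real_def)
    then have "\<forall>\<^sub>F t in sequentially. \<forall>j. \<bar>h (r t) j - c * v j\<bar> < d * v j"
      by (rule eventually_all_finite)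
    then obtain t where t: "\<And>j. \<bar>h (r t) j - c * v j\<bar> < d * v j"
      using eventually_happens'[OF sequentially_bot] by blast
    have "norm (h s i - c * v i) < e" if "s \<ge> r t" for s
    proof -
      have "h (r t) j \<le> (c + d) * v j" "(c - d) * v j \<le> h (r t) j" for j
        using t[of j] by (auto simp: algebra_simps abs_less_iff)
      then have "h s i \<le> (c + d) * v i" "(c - d) * v i \<le> h s i"
        using upper_barrier[OF harmonic_scale[OF v(1)] _ that]
          lower_barrier[OF harmonic_scale[OF v(1)] _ that] by blast+
      moreover have "d * v i = e / 2" using v(2)[of i] by (simp add: d_def)
      ultimately show ?thesis using e by (simp add: algebra_simps abs_less_iff)
    qed
    then show "\<exists>n0. \<forall>n\<ge>n0. norm (h n i - c * v i) < e" by blast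
  qed
  then show thesis using that[OF harmonic_scale[OF v(1)]] by blast
qed

end

section \<open>The quantized recursion\<close>

lemma quant_minus: "quant m d g (- \<beta>) = - quant m d g \<beta>"
  by (simp add: quant_def)

text \<open>
  The three properties follow from \<open>0 \<le> \<lceil>y\<rceil> - 1 \<le> y\<close> for \<open>y > 0\<close>: rounding up and subtracting
  1 rounds towards 0 and so never exceeds the balance.
\<close>

lemma quant_nonneg_le:
  assumes d: "0 < d" and g: "0 < g" and \<beta>: "0 \<le> \<beta>"
  shows "0 \<le> quant m d g \<beta>" "quant m d g \<beta> \<le> 1" "real d * (g * quant m d g \<beta>) \<le> \<beta>"
proof -
  define y where "y = 2 ^ m * \<beta> / (2 * real d * g)"
  define z where "z = 2 / 2 ^ m * (of_int \<lceil>y\<rceil> - 1 :: real)"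
  have q: "quant m d g \<beta> = (if m \<ge> 1 \<and> \<beta> > 0 then min z 1 else 0)"
    using \<beta> by (simp add: quant_def z_def y_def sgn_if)
  have z0: "0 \<le> z" if "\<beta> > 0"
  proof -
    have "0 < y" using that d g by (simp add: y_def)
    then have "1 \<le> \<lceil>y\<rceil>" by simp
    then have "(1 :: real) \<le> of_int \<lceil>y\<rceil>" by simp
    then show ?thesis by (simp add: z_def)
  qed
  have "z \<le> 2 / 2 ^ m * y"
    unfolding z_def using ceiling_correct[of y] by (intro mult_left_mono) auto
  also have "\<dots> = \<beta> / (real d * g)" by (simp add: y_def)
  finally have "real d * (g * z) \<le> \<beta>"
    using d g by (simp add: pos_le_divide_eq mult.assoc mult.commute mult.left_commute)
  moreover have "real d * (g * min z 1) \<le> real d * (g * z)"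
    using d g by (intro mult_left_mono) auto
  ultimately show "0 \<le> quant m d g \<beta>" "quant m d g \<beta> \<le> 1" "real d * (g * quant m d g \<beta>) \<le> \<beta>"
    using z0 \<beta> by (auto simp: q)
qed

text \<open>
  The argument of the ceiling exceeds the integer \<open>2\<^sup>m\<^sup>-\<^sup>1\<close>, so \<open>\<lceil>y\<rceil> - 1\<close> is at least \<open>2\<^sup>m\<^sup>-\<^sup>1\<close>.  The
  threshold does not depend on the number of bits.
\<close>

lemma quant_saturated:
  assumes d: "0 < d" and g: "0 < g" and m: "1 \<le> m" and \<beta>: "real d * g < \<beta>"
  shows "quant m d g \<beta> = 1"
proof -
  define y where "y = 2 ^ m * \<beta> / (2 * real d * g)"
  obtain m' where m': "m = Suc m'" using m by (cases m) auto
  have dg: "0 < real d * g" using d g by simp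
  then have \<beta>0: "0 < \<beta>" using \<beta> by linarith
  have "2 ^ m' < y"
    using dg \<beta> by (simp add: y_def m' pos_less_divide_eq mult.assoc)
  then have "of_int (2 ^ m') < y" by simp
  then have "2 ^ m' + 1 \<le> \<lceil>y\<rceil>" by (simp add: less_ceiling_iff add1_zle_eq)
  then have "real_of_int (2 ^ m' + 1) \<le> of_int \<lceil>y\<rceil>" by (simp only: of_int_le_iff)
  then have "(2 ^ m' :: real) \<le> of_int \<lceil>y\<rceil> - 1" by simp
  then have "2 / 2 ^ m * (2 ^ m' :: real) \<le> 2 / 2 ^ m * (of_int \<lceil>y\<rceil> - 1)"
    by (intro mult_left_mono) auto
  then have "1 \<le> 2 / 2 ^ m * (of_int \<lceil>y\<rceil> - 1 :: real)" by (simp add: m')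
  then show ?thesis using \<beta>0 m by (simp add: quant_def y_def)
qed

text \<open>
  In the epoch with \<open>\<gamma> = c\<^sub>1\<^sup>-\<^sup>n\<close> the number \<open>k + c\<^sub>2\<close> lies between \<open>c\<^sub>1\<^sup>n c\<^sub>2\<close> and \<open>c\<^sub>1\<^sup>n\<^sup>+\<^sup>1 c\<^sub>2\<close>.
\<close>

lemma step_size_bounds:
  assumes "step_size_assumption \<gamma>"
  shows "\<exists>c c' :: real. 0 < c \<and> 0 < c' \<and>
    (\<forall>k. c / (real k + c) \<le> \<gamma> k \<and> \<gamma> k \<le> c' * c / (real k + c))"
proof -
  obtain c1 :: nat and c :: real where c1: "2 \<le> c1" and c: "0 < c"
    and epoch: "\<And>k. \<exists>n. (real c1 ^ n - 1) * c \<le> real k \<and>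
        real k \<le> (real c1 ^ (n + 1) - 1) * c - 1 \<and> \<gamma> k = 1 / real c1 ^ n"
    using assms unfolding step_size_assumption_def by blast
  have "c / (real k + c) \<le> \<gamma> k \<and> \<gamma> k \<le> real c1 * c / (real k + c)" for k
  proof -
    obtain n where n: "(real c1 ^ n - 1) * c \<le> real k"
      "real k \<le> (real c1 ^ (n + 1) - 1) * c - 1" "\<gamma> k = 1 / real c1 ^ n"
      using epoch by blast
    have pos: "0 < real c1 ^ n" "0 < real k + c" using c1 c by (auto simp: add_nonneg_pos)
    have "c * real c1 ^ n \<le> real k + c" using n(1) by (simp add: algebra_simps)
    moreover have "real k + c \<le> real c1 * c * real c1 ^ n" using n(2) by (simp add: algebra_simps)
    ultimately show ?thesis using pos by (simp add: n(3) pos_divide_le_eq pos_le_divide_eq)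
  qed
  then show ?thesis using c c1 by (intro exI[of _ c] exI[of _ "real c1"]) auto
qed

lemma active_blocks:
  assumes "bit_assumption B"
  obtains active :: "nat \<Rightarrow> bool" and W :: nat
  where "\<And>i k. active k \<Longrightarrow> 1 \<le> B i k" "\<And>i k. \<not> active k \<Longrightarrow> B i k = 0" "0 < W"
    "\<And>n. \<exists>t. n * W \<le> t \<and> t < Suc n * W \<and> active t"
proof -
  obtain Bw :: "nat \<Rightarrow> nat" and W Bmax :: nat where Bw: "\<And>k. Bw k \<in> {0, 1}" and W: "1 \<le> W"
    and blocks: "\<And>n. (\<Sum>t = n * W..(n + 1) * W - 1. Bw t) \<ge> 1"
    and B: "\<And>i k. (Bw k = 1 \<longrightarrow> 1 \<le> B i k \<and> B i k \<le> Bmax) \<and> (Bw k = 0 \<longrightarrow> B i k = 0)"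
    using assms unfolding bit_assumption_def by blast
  have "\<exists>t. n * W \<le> t \<and> t < Suc n * W \<and> Bw t = 1" for n
  proof (rule ccontr)
    assume none: "\<not> ?thesis"
    have "Bw t = 0" if "t \<in> {n * W..(n + 1) * W - 1}" for t
    proof -
      have "n * W \<le> t" "t < Suc n * W" using that W by auto
      then show ?thesis using none Bw[of t] by blast
    qed
    then have "(\<Sum>t = n * W..(n + 1) * W - 1. Bw t) = 0" by simp
    then show False using blocks[of n] by simp
  qed
  then show thesis
  proof (rule that[of "\<lambda>k. Bw k = 1" W, rotated 3])
    show "1 \<le> B i k" if "Bw k = 1" for i k using B that by blast
    show "B i k = 0" if "Bw k \<noteq> 1" for i k using B Bw[of k] that by blast
  qed (use W in simp)
qed

text \<open>
  The increments of \<open>A $ i $ j\<close> do not depend on \<open>i\<close>, so \<open>h k j\<close> can be defined as the sum of the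
  increments for sender \<open>j\<close>, and induction recovers the weights and the balances from it.
\<close>

lemma weight_balancing_is_balancing:
  assumes G: "strong_digraph G" and B: "bit_assumption B" and \<gamma>: "step_size_assumption \<gamma>"
    and init: "init_assumption G (A 0)" and rec: "weight_balancing G B \<gamma> A b"
  obtains h x active W where "balancing G h (\<lambda>t. ($) (b t)) x \<gamma> active"
    "0 < W" "\<And>n. \<exists>t. n * W \<le> t \<and> t < Suc n * W \<and> active t"
    "\<And>i. h 0 i = 1" "\<And>k i j. A k $ i $ j = (if (j, i) \<in> parcs G then h k j else 0)"
proof (rule active_blocks[OF B])
  interpret strong_digraph G by (rule G)
  fix active W
  assume act: "\<And>i k. active k \<Longrightarrow> 1 \<le> B i k" "\<And>i k. \<not> active k \<Longrightarrow> B i k = 0"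
    "0 < W" "\<And>n. \<exists>t. n * W \<le> t \<and> t < Suc n * W \<and> active t"
  have \<gamma>0: "0 < \<gamma> t" for t
  proof -
    obtain c :: real where c: "0 < c" "c / (real t + c) \<le> \<gamma> t"
      using step_size_bounds[OF \<gamma>] by blast
    have "0 < c / (real t + c)" using c(1) by (simp add: add_nonneg_pos)
    then show ?thesis using c(2) by linarith
  qed
  define x where "x t i = \<gamma> t * quant (B i t) (out_deg G i) (\<gamma> t) (b t $ i)" for t i
  define h where "h t i = 1 + (\<Sum>s<t. x s i)" for t i
  have b0: "b 0 $ i = (\<Sum>j\<in>in_nbrs G i. A 0 $ i $ j) - (\<Sum>j\<in>out_nbrs G i. A 0 $ j $ i)"
    and A_Suc: "j \<in> in_nbrs G i \<Longrightarrow> A (Suc k) $ i $ j = A k $ i $ j + x k j"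
    and A_off: "(j, i) \<notin> parcs G \<Longrightarrow> A k $ i $ j = 0"
    and b_Suc: "b (Suc k) $ i = b k $ i - real (out_deg G i) * x k i + (\<Sum>j\<in>in_nbrs G i. x k j)"
    for i j k
    using rec by (simp_all add: weight_balancing_def Let_def x_def sum_distrib_left mult_ac)
  have A_arc: "A k $ i $ j = h k j" if "(j, i) \<in> parcs G" for i j k
  proof (induction k)
    case 0
    then show ?case using init that by (simp add: init_assumption_def h_def)
  next
    case (Suc k)
    then show ?case using A_Suc[of j i k] that by (simp add: in_nbrs_def h_def)
  qed
  have b_eq: "b t $ i = (\<Sum>j\<in>in_nbrs G i. h t j) - real (out_deg G i) * h t i" for t i
  proof (induction t)
    case 0
    have "(\<Sum>j\<in>in_nbrs G i. A 0 $ i $ j) = (\<Sum>j\<in>in_nbrs G i. h 0 j)"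
      by (intro sum.cong refl A_arc) (simp add: in_nbrs_def)
    moreover have "(\<Sum>j\<in>out_nbrs G i. A 0 $ j $ i) = (\<Sum>j\<in>out_nbrs G i. h 0 i)"
      by (intro sum.cong refl A_arc) (simp add: out_nbrs_def)
    ultimately show ?case by (simp add: b0 out_deg_def)
  next
    case (Suc t)
    then show ?case by (simp add: b_Suc h_def sum.distrib algebra_simps)
  qed
  have pos: "0 \<le> x t i \<and> x t i \<le> \<gamma> t \<and> real (out_deg G i) * x t i \<le> b t $ i"
    if "0 \<le> b t $ i" for t i
    using quant_nonneg_le[OF out_deg_pos[of i] \<gamma>0[of t] that, of "B i t"] \<gamma>0[of t]
    by (simp add: x_def mult_le_cancel_left1)
  have neg: "x t i \<le> 0 \<and> - \<gamma> t \<le> x t i \<and> b t $ i \<le> real (out_deg G i) * x t i"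
    if "b t $ i \<le> 0" for t i
  proof -
    define q where "q = quant (B i t) (out_deg G i) (\<gamma> t) (- (b t $ i))"
    have "0 \<le> - (b t $ i)" using that by simp
    note q = quant_nonneg_le[OF out_deg_pos[of i] \<gamma>0[of t] this, of "B i t", folded q_def]
    have "x t i = - (\<gamma> t * q)" by (simp add: x_def q_def quant_minus)
    moreover have "0 \<le> \<gamma> t * q" "\<gamma> t * q \<le> \<gamma> t"
      using q(1,2) \<gamma>0[of t] by (auto simp: mult_le_cancel_left2)
    ultimately show ?thesis using q(3) by simp
  qed
  have "balancing G h (\<lambda>t. ($) (b t)) x \<gamma> active"
  proof
    show "h (Suc t) i = h t i + x t i" for t i by (simp add: h_def)
    show "b t $ i = (\<Sum>j\<in>in_nbrs G i. h t j) - real (out_deg G i) * h t i" for t i by (rule b_eq)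
    show "0 \<le> x t i \<and> real (out_deg G i) * x t i \<le> b t $ i" if "0 \<le> b t $ i" for t i
      using pos[OF that] by blast
    show "x t i \<le> 0 \<and> b t $ i \<le> real (out_deg G i) * x t i" if "b t $ i \<le> 0" for t i
      using neg[OF that] by blast
    show "\<bar>x t i\<bar> \<le> \<gamma> t" for t i
      using pos[of t i] neg[of t i] by linarith
    show "x t i = \<gamma> t" if "active t" "real (out_deg G i) * \<gamma> t < b t $ i" for t i
      using quant_saturated[OF out_deg_pos \<gamma>0 act(1)[OF that(1)] that(2)] by (simp add: x_def)
    show "x t i = 0" if "\<not> active t" for t i
      using act(2)[OF that] by (simp add: x_def quant_def)
  qed
  then show thesis
  proof (rule that[of h x active W])
    show "h 0 i = 1" for i by (simp add: h_def)
    show "A k $ i $ j = (if (j, i) \<in> parcs G then h k j else 0)" for k i j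
      by (simp add: A_arc A_off)
  qed (use act(3,4) in auto)
qed

theorem theorem2:
  fixes G :: "'n::finite pair_pre_digraph"
    and B :: "'n \<Rightarrow> nat \<Rightarrow> nat"
    and \<gamma> :: "nat \<Rightarrow> real"
    and A :: "nat \<Rightarrow> real^'n^'n"
    and b :: "nat \<Rightarrow> real^'n"
  assumes "CARD('n) \<ge> 2"
    and "pair_digraph G"
    and "pverts G = UNIV"
    and "strongly_connected (with_proj G)"
    and "bit_assumption B"
    and "step_size_assumption \<gamma>"
    and "init_assumption G (A 0)"
    and "weight_balancing G B \<gamma> A b"
  shows "(\<forall>k. b k = (A k - transpose (A k)) *v vec 1)
    \<and> (\<lambda>k. \<Sum>i\<in>UNIV. \<bar>b k $ i\<bar>) \<in> O(\<lambda>k. 1 / real k)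
    \<and> (\<exists>Astar. A \<longlonglongrightarrow> Astar \<and> weight_balanced Astar)
    \<and> 0 < a_min G (A 0)
    \<and> (\<forall>i j k. (j, i) \<in> parcs G \<longrightarrow>
         a_min G (A 0) \<le> A k $ i $ j \<and> A k $ i $ j \<le> a_max G (A 0))"
proof -
  have "strong_digraph G"
  proof
    fix u v
    have "u \<rightarrow>\<^sup>*\<^bsub>with_proj G\<^esub> v"
      using assms(3,4) by (simp add: strongly_connected_def)
    then show "(u, v) \<in> (parcs G)\<^sup>*" using reachable_rtranclI by fastforce
  qed (rule assms(1))
  then show ?thesis
  proof (rule weight_balancing_is_balancing[OF _ assms(5-8)])
    fix h x active W
    assume bal: "balancing G h (\<lambda>t. ($) (b t)) x \<gamma> active"
      and W: "0 < W" "\<And>n. \<exists>t. n * W \<le> t \<and> t < Suc n * W \<and> active t"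
      and h0: "\<And>i. h 0 i = 1"
      and A: "\<And>k i j. A k $ i $ j = (if (j, i) \<in> parcs G then h k j else 0)"
    interpret balancing G h "\<lambda>t. ($) (b t)" x \<gamma> active by (rule bal)
    note low = a_m_spec[OF assms(7)] and high = a_M_spec[OF assms(7)]

    have balance: "b k = (A k - transpose (A k)) *v vec 1" for k
      by (rule iffD2[OF vec_eq_iff], intro allI, subst out_weight_balance[OF A], rule b_eq)

    obtain c c' where c: "0 < c" "0 < c'"
      "\<And>k. c / (real k + c) \<le> \<gamma> k" "\<And>k. \<gamma> k \<le> c' * c / (real k + c)"
      using step_size_bounds[OF assms(6)] by blast
    obtain K where K: "\<And>k. imbalance k \<le> K / real (Suc k)" using imbalance_bound[OF W c] by blast
    have imbalance_nonneg: "0 \<le> imbalance k" for k by (simp add: imbalance_def sum_nonneg)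
    have rate: "(\<lambda>k. \<Sum>i\<in>UNIV. \<bar>b k $ i\<bar>) \<in> O(\<lambda>k. 1 / real k)"
    proof (rule bigoI[of _ K])
      have "0 \<le> K" using K[of 0] imbalance_nonneg[of 0] by simp
      then have "K / real (Suc k) \<le> K / real k" if "k \<ge> 1" for k
        using that by (intro divide_left_mono) auto
      then have "norm (imbalance k) \<le> K * norm (1 / real k)" if "k \<ge> 1" for k
        using order_trans[OF K[of k]] imbalance_nonneg[of k] that by simp
      then show "\<forall>\<^sub>F k in sequentially. norm (\<Sum>i\<in>UNIV. \<bar>b k $ i\<bar>) \<le> K * norm (1 / real k)"
        unfolding eventually_sequentially imbalance_def[symmetric] by blast
    qed

    have a_min_le: "a_min G (A 0) \<le> a_m G (A 0) $ i" for i
      unfolding a_min_def by (rule Min_le) auto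
    have a_min_pos: "0 < a_min G (A 0)"
      unfolding a_min_def using low(2) by (subst Min_gr_iff) auto
    have h_low: "a_min G (A 0) \<le> h k i" for k i
    proof -
      have "a_m G (A 0) $ j \<le> h 0 j" for j
        unfolding h0 low(3)[symmetric] by (rule Max_ge) auto
      from lower_barrier[OF low(1) this, of k i] show ?thesis using a_min_le[of i] by simp
    qed
    have h_high: "h k i \<le> a_max G (A 0)" for k i
    proof -
      have "h 0 j \<le> a_M G (A 0) $ j" for j
        unfolding h0 high(3)[symmetric] by (rule Min_le) auto
      moreover have "a_M G (A 0) $ i \<le> a_max G (A 0)"
        unfolding a_max_def by (rule Max_ge) auto
      ultimately show ?thesis using upper_barrier[OF high(1), of 0 k i] by fastforce
    qed

    have imbalance_lim: "imbalance \<longlonglongrightarrow> 0"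
    proof (rule tendsto_sandwich[OF _ _ tendsto_const])
      show "(\<lambda>k. K / real (Suc k)) \<longlonglongrightarrow> 0"
        using LIMSEQ_Suc[OF lim_const_over_n[of K]] by simp
    qed (use K imbalance_nonneg in auto)
    obtain w where w: "harmonic w" "\<And>i. (\<lambda>t. h t i) \<longlonglongrightarrow> w i"
      using h_converges[OF imbalance_lim] by blast
    define Astar :: "real^'n^'n" where "Astar = (\<chi> i j. if (j, i) \<in> parcs G then w j else 0)"
    have lim: "A \<longlonglongrightarrow> Astar"
    proof (intro vec_tendstoI)
      show "(\<lambda>k. A k $ i $ j) \<longlonglongrightarrow> Astar $ i $ j" for i j
        using w(2)[of j] by (simp add: A Astar_def)
    qed
    have w_low: "a_min G (A 0) \<le> w i" for i
      using h_low by (intro LIMSEQ_le_const[OF w(2)]) auto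
    have "weight_balanced Astar"
      unfolding weight_balanced_def
    proof (intro conjI allI)
      show "0 \<le> Astar $ i $ j" for i j
        using w_low[of j] a_min_pos by (simp add: Astar_def)
      have "out_nbrs G j \<noteq> {}" for j
        using out_deg_pos[of j] by (auto simp: out_deg_def)
      then obtain i j where ij: "(j, i) \<in> parcs G" by (fastforce simp: out_nbrs_def)
      then have "Astar $ i $ j > 0" using w_low[of j] a_min_pos by (simp add: Astar_def)
      then show "Astar \<noteq> 0" by auto
      have "((Astar - transpose Astar) *v vec 1) $ i = 0" for i
        using w(1) by (subst out_weight_balance[where u = w]) (auto simp: Astar_def harmonic_def)
      then show "(Astar - transpose Astar) *v vec 1 = 0" by (simp add: vec_eq_iff)
    qed
    then show ?thesis
      using balance rate lim a_min_pos h_low h_high by (auto simp: A)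
  qed
qed

end
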